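(* Let $A$ be a finite alphabet containing two distinct letters $a,b$, let $k\ge1$, and let $n_1,\dots,n_k$, $B$, $N$ be positive integers. Then the quadratic equation $$\prod_{j=1}^{k} z_j^{-1}[a,b^{n_j}]z_j=[a^N,b^B]$$ in the variables $z_1,\dots,z_k$ has a solution in the free group $F(A)$ if and only if there is a partition $$\{1,\dots,k\}=S_1\sqcup\dots\sqcup S_N$$ into $N$ subsets such that $\sum_{j\in S_i}n_j=B$ for each $i=1,\dots,N$ (that is, the Exact Bin Packing problem with input $(n_1,\dots,n_k)$, $B$, $N$ has a positive answer).
   Context: $[x,y]=x^{-1}y^{-1}xy$. A solution is an assignment of elements of $F(A)$ to $z_1,\dots,z_k$ making the equation true in $F(A)$. The Exact Bin Packing problem: given a $k$-tuple of positive integers $(r_1,\dots,r_k)$ and positive integers $B,N$, decide whether there is a partition of $\{1,\dots,k\}$ into $N$ subsets $S_1,\dots,S_N$ with $\sum_{j\in S_i}r_j=B$ for every $i$. *)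

theory Defs
  imports "HOL-Algebra.Group" "HOL-Library.Disjoint_Sets"
begin

section \<open>The free group on a set of letters\<close>

text \<open>
  The letter \<open>(x, True)\<close> stands for \<open>x\<close> and \<open>(x, False)\<close> for its formal inverse.
  Elements of the free group are the freely reduced words.
\<close>

type_synonym 'a letter = "'a \<times> bool"

definition inv_letter :: "'a letter \<Rightarrow> 'a letter" where
  "inv_letter s = (fst s, \<not> snd s)"

definition reduced :: "'a letter list \<Rightarrow> bool" where
  "reduced w \<longleftrightarrow> successively (\<lambda>s t. t \<noteq> inv_letter s) w"

text \<open>Multiplication of a reduced word by one letter on the left, with free cancellation.\<close>

fun push :: "'a letter \<Rightarrow> 'a letter list \<Rightarrow> 'a letter list" where
  "push s [] = [s]"
| "push s (t # w) = (if t = inv_letter s then w else s # t # w)"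

definition free_group :: "'a set \<Rightarrow> 'a letter list monoid" where
  "free_group A =
     \<lparr>carrier = {w. reduced w \<and> fst ` set w \<subseteq> A}, mult = foldr push, one = []\<rparr>"

definition gen :: "'a \<Rightarrow> 'a letter list" where
  "gen x = [(x, True)]"

lemma inv_letter_simps [simp]:
  "inv_letter (inv_letter s) = s" "fst (inv_letter s) = fst s"
  "inv_letter s \<noteq> s" "s \<noteq> inv_letter s" "inv_letter (x, e) = (x, \<not> e)"
  by (auto simp: inv_letter_def prod_eq_iff)

lemma reduced_simps [simp]:
  "reduced []" "reduced [s]"
  "reduced (s # t # w) \<longleftrightarrow> t \<noteq> inv_letter s \<and> reduced (t # w)"
  by (auto simp: reduced_def)

lemma reduced_ConsD: "reduced (s # w) \<Longrightarrow> reduced w"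
  by (cases w) auto

lemma reduced_push: "reduced w \<Longrightarrow> reduced (push s w)"
  by (cases w) (auto dest: reduced_ConsD)

lemma set_push: "fst ` set (push s w) \<subseteq> insert (fst s) (fst ` set w)"
  by (cases w) auto

lemma push_inv: "reduced w \<Longrightarrow> push (inv_letter s) (push s w) = w"
proof (cases w)
  case (Cons t v)
  assume "reduced w"
  with Cons show ?thesis by (cases v) auto
qed simp

lemma push_inv': "reduced w \<Longrightarrow> push s (push (inv_letter s) w) = w"
  using push_inv[of w "inv_letter s"] by simp

lemma reduced_foldr: "reduced v \<Longrightarrow> reduced (foldr push u v)"
  by (induction u) (auto intro: reduced_push)

lemma set_foldr: "fst ` set (foldr push u v) \<subseteq> fst ` set u \<union> fst ` set v"
proof (induction u)
  case (Cons s u)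
  have "fst ` set (push s (foldr push u v)) \<subseteq> insert (fst s) (fst ` set (foldr push u v))"
    by (rule set_push)
  also have "\<dots> \<subseteq> insert (fst s) (fst ` set u \<union> fst ` set v)"
    using Cons.IH by (rule insert_mono)
  finally show ?case by simp
qed simp

lemma foldr_push: "reduced v \<Longrightarrow> foldr push (push s u) v = push s (foldr push u v)"
  by (cases u) (auto simp: push_inv' reduced_foldr)

lemma foldr_assoc:
  "reduced w \<Longrightarrow> foldr push (foldr push u v) w = foldr push u (foldr push v w)"
  by (induction u) (auto simp: foldr_push)

lemma foldr_Nil: "reduced w \<Longrightarrow> foldr push w [] = w"
proof (induction w)
  case (Cons s w)
  then have "foldr push w [] = w" by (auto dest: reduced_ConsD)
  with Cons.prems show ?case by (cases w) auto
qed simp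

lemma foldr_inverse:
  "reduced v \<Longrightarrow> foldr push (rev (map inv_letter u)) (foldr push u v) = v"
  by (induction u) (auto simp: push_inv reduced_foldr)

lemma reduced_inverse: "reduced w \<Longrightarrow> reduced (rev (map inv_letter w))"
  unfolding reduced_def successively_rev successively_map
  by (erule successively_mono) (metis inv_letter_simps(1))

lemma group_free_group: "group (free_group A)"
proof (rule groupI)
  fix x assume "x \<in> carrier (free_group A)"
  then show "\<exists>y\<in>carrier (free_group A). y \<otimes>\<^bsub>free_group A\<^esub> x = \<one>\<^bsub>free_group A\<^esub>"
    using foldr_inverse[of "[]" x]
    by (intro bexI[of _ "rev (map inv_letter x)"])
      (auto simp: free_group_def foldr_Nil intro: reduced_inverse)
next
  fix x y assume "x \<in> carrier (free_group A)" "y \<in> carrier (free_group A)"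
  then show "x \<otimes>\<^bsub>free_group A\<^esub> y \<in> carrier (free_group A)"
    using subset_trans[OF set_foldr[of x y], of A] by (simp add: free_group_def reduced_foldr)
qed (auto simp: free_group_def foldr_assoc)

lemma inv_free_group:
  assumes "w \<in> carrier (free_group A)"
  shows "inv\<^bsub>free_group A\<^esub> w = rev (map inv_letter w)"
proof (rule group.inv_equality[OF group_free_group])
  show "rev (map inv_letter w) \<otimes>\<^bsub>free_group A\<^esub> w = \<one>\<^bsub>free_group A\<^esub>"
    using assms foldr_inverse[of "[]" w] by (simp add: free_group_def foldr_Nil)
qed (use assms in \<open>auto simp: free_group_def intro: reduced_inverse\<close>)

lemma gen_closed: "x \<in> A \<Longrightarrow> gen x \<in> carrier (free_group A)"
  by (simp add: gen_def free_group_def)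

text \<open>The universal property of the free group.\<close>

definition lift_letter :: "('b, 'm) monoid_scheme \<Rightarrow> ('a \<Rightarrow> 'b) \<Rightarrow> 'a letter \<Rightarrow> 'b" where
  "lift_letter G f s = (if snd s then f (fst s) else inv\<^bsub>G\<^esub> f (fst s))"

definition lift :: "('b, 'm) monoid_scheme \<Rightarrow> ('a \<Rightarrow> 'b) \<Rightarrow> 'a letter list \<Rightarrow> 'b" where
  "lift G f w = foldr (\<lambda>s g. lift_letter G f s \<otimes>\<^bsub>G\<^esub> g) w \<one>\<^bsub>G\<^esub>"

lemma lift_hom:
  assumes "group G" and f: "f \<in> A \<rightarrow> carrier G"
  shows "lift G f \<in> hom (free_group A) G" and "x \<in> A \<Longrightarrow> lift G f (gen x) = f x"
proof -
  interpret group G by fact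
  have letter: "lift_letter G f s \<in> carrier G" if "fst s \<in> A" for s
    using that f by (auto simp: lift_letter_def)
  have inverse: "lift_letter G f (inv_letter s) = inv\<^bsub>G\<^esub> lift_letter G f s" if "fst s \<in> A" for s
    using that funcset_mem[OF f, of "fst s"] by (auto simp: lift_letter_def inv_letter_def)
  have closed: "lift G f w \<in> carrier G" if "fst ` set w \<subseteq> A" for w
    using that by (induction w) (auto simp: lift_def letter)
  have push: "lift G f (push s w) = lift_letter G f s \<otimes>\<^bsub>G\<^esub> lift G f w"
    if "fst s \<in> A" "fst ` set w \<subseteq> A" for s w
  proof (cases w)
    case (Cons t v)
    then have "lift G f v \<in> carrier G" using that closed by auto
    with Cons that show ?thesis
      by (auto simp: lift_def letter inverse m_assoc[symmetric])
  qed (simp add: lift_def)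
  have mult: "lift G f (foldr push u v) = lift G f u \<otimes>\<^bsub>G\<^esub> lift G f v"
    if "fst ` set u \<subseteq> A" "fst ` set v \<subseteq> A" for u v
    using that(1)
  proof (induction u)
    case Nil
    then show ?case using closed[OF that(2)] by (simp add: lift_def)
  next
    case (Cons s u)
    then have "fst ` set (foldr push u v) \<subseteq> A"
      using subset_trans[OF set_foldr[of u v], of A] that(2) by simp
    with Cons that(2) closed[of u] closed[of v] letter[of s] show ?case
      by (auto simp: push m_assoc) (simp add: lift_def m_assoc)
  qed
  show "lift G f \<in> hom (free_group A) G"
    by (auto simp: hom_def free_group_def closed mult)
  show "lift G f (gen x) = f x" if "x \<in> A"
    using funcset_mem[OF f that] by (simp add: lift_def lift_letter_def gen_def)
qed

lemma lift_unique:
  assumes "group G" and h: "h \<in> hom (free_group A) G" and "\<And>x. x \<in> A \<Longrightarrow> h (gen x) = f x"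
    and "w \<in> carrier (free_group A)"
  shows "h w = lift G f w"
proof -
  interpret G: group G by fact
  interpret F: group "free_group A" by (rule group_free_group)
  interpret group_hom "free_group A" G h
    using h by unfold_locales
  show ?thesis using assms(4)
  proof (induction w)
    case Nil
    have "h [] = \<one>\<^bsub>G\<^esub>" using hom_one by (simp add: free_group_def)
    then show ?case by (simp add: lift_def)
  next
    case (Cons s w)
    then have w: "w \<in> carrier (free_group A)" and s: "fst s \<in> A"
      by (auto simp: free_group_def dest: reduced_ConsD)
    have sc: "[s] \<in> carrier (free_group A)" using s by (simp add: free_group_def)
    have "s # w = [s] \<otimes>\<^bsub>free_group A\<^esub> w"
      using Cons.prems by (cases w) (auto simp: free_group_def)
    then have "h (s # w) = h [s] \<otimes>\<^bsub>G\<^esub> h w" using sc w by simp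
    moreover have "h [s] = lift_letter G f s"
    proof (cases "snd s")
      case True
      then show ?thesis using assms(3)[OF s] by (cases s) (simp add: lift_letter_def gen_def)
    next
      case False
      then have "[s] = inv\<^bsub>free_group A\<^esub> gen (fst s)"
        using inv_free_group[OF gen_closed[OF s]] by (cases s) (simp add: gen_def)
      with False show ?thesis
        using assms(3)[OF s] gen_closed[OF s] by (simp add: lift_letter_def)
    qed
    ultimately show ?case using Cons.IH[OF w] by (simp add: lift_def)
  qed
qed

section \<open>Commutators and ordered products\<close>

definition commutator :: "('g, 'm) monoid_scheme \<Rightarrow> 'g \<Rightarrow> 'g \<Rightarrow> 'g" where
  "commutator G x y = inv\<^bsub>G\<^esub> x \<otimes>\<^bsub>G\<^esub> inv\<^bsub>G\<^esub> y \<otimes>\<^bsub>G\<^esub> x \<otimes>\<^bsub>G\<^esub> y"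

text \<open>The product \<open>f 1 \<otimes> f 2 \<otimes> \<dots> \<otimes> f k\<close>, in this order (\<open>G\<close> need not be commutative).\<close>

primrec ordered_prod :: "('g, 'm) monoid_scheme \<Rightarrow> (nat \<Rightarrow> 'g) \<Rightarrow> nat \<Rightarrow> 'g" where
  "ordered_prod G f 0 = \<one>\<^bsub>G\<^esub>"
| "ordered_prod G f (Suc k) = ordered_prod G f k \<otimes>\<^bsub>G\<^esub> f (Suc k)"

section \<open>Exact Bin Packing\<close>

text \<open>
  The parts are indexed by \<open>{1..N}\<close>. When \<open>B > 0\<close> they are automatically nonempty and hence
  pairwise distinct, so they form a partition into exactly \<open>N\<close> blocks.
\<close>

definition exact_bin_packing :: "nat \<Rightarrow> (nat \<Rightarrow> nat) \<Rightarrow> nat \<Rightarrow> nat \<Rightarrow> bool" where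
  "exact_bin_packing k r B N \<longleftrightarrow>
     (\<exists>S :: nat \<Rightarrow> nat set. (\<Union>i\<in>{1..N}. S i) = {1..k} \<and> disjoint_family_on S {1..N} \<and>
        (\<forall>i\<in>{1..N}. (\<Sum>j\<in>S i. r j) = B))"

end

theory Submission
  imports Defs
begin

text \<open>
  Map \<open>F(A)\<close> to the restricted wreath product of two infinite cyclic groups, sending \<open>a\<close> to the
  generator of the top group and \<open>b\<close> to the generator of the copy of the base group at position
  \<open>0\<close>. A conjugate of \<open>[a, b\<^sup>n]\<close> goes to \<open>n (\<delta>\<^sub>c - \<delta>\<^sub>c\<^sub>-\<^sub>1)\<close> for some position \<open>c\<close>, whereas
  \<open>[a\<^sup>N, b\<^sup>B]\<close> goes to \<open>B (\<delta>\<^sub>0 - \<delta>\<^sub>-\<^sub>N)\<close>. Hence in a solution the \<open>n\<^sub>j\<close> located at a position \<open>c\<close>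
  have total \<open>B\<close> if \<open>-N < c \<le> 0\<close> and \<open>0\<close> otherwise: the positions are the bins. Conversely, the
  identities \<open>[x, yz] = [x, z] [x, y]\<^sup>z\<close> and \<open>[xy, z] = [x, z]\<^sup>y [y, z]\<close> turn a packing into a
  product of conjugates, whose factors can be put into any order.
\<close>

section \<open>Products of conjugates\<close>

text \<open>One conjugate of each \<open>c j\<close> with \<open>j\<close> in \<open>J\<close> is
  multiplied up. Only the set of indices used is recorded, so bins can be filled in any order and
  the order required by the equation is restored at the end.\<close>

inductive conj_prod ::
  "('g, 'm) monoid_scheme \<Rightarrow> ('i \<Rightarrow> 'g) \<Rightarrow> 'i set \<Rightarrow> 'g \<Rightarrow> bool" for G c where
  empty: "conj_prod G c {} \<one>\<^bsub>G\<^esub>"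
| insert: "\<lbrakk>conj_prod G c J g; j \<notin> J; z \<in> carrier G\<rbrakk>
    \<Longrightarrow> conj_prod G c (insert j J) (g \<otimes>\<^bsub>G\<^esub> (inv\<^bsub>G\<^esub> z \<otimes>\<^bsub>G\<^esub> c j \<otimes>\<^bsub>G\<^esub> z))"

context group
begin

section \<open>Commutators and products of conjugates in an arbitrary group\<close>

lemma inv_cancel:
  assumes "x \<in> carrier G" "y \<in> carrier G"
  shows "inv x \<otimes> (x \<otimes> y) = y" "x \<otimes> (inv x \<otimes> y) = y"
  using assms by (simp_all add: m_assoc[symmetric])

lemma commutator_closed:
  "x \<in> carrier G \<Longrightarrow> y \<in> carrier G \<Longrightarrow> commutator G x y \<in> carrier G"
  by (simp add: commutator_def)

lemma commutator_mult_right: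
  assumes "x \<in> carrier G" "y \<in> carrier G" "z \<in> carrier G"
  shows "commutator G x (y \<otimes> z) = commutator G x z \<otimes> (inv z \<otimes> commutator G x y \<otimes> z)"
  using assms by (simp add: commutator_def m_assoc inv_mult_group inv_cancel)

lemma commutator_mult_left:
  assumes "x \<in> carrier G" "y \<in> carrier G" "z \<in> carrier G"
  shows "commutator G (x \<otimes> y) z = inv y \<otimes> commutator G x z \<otimes> y \<otimes> commutator G y z"
  using assms by (simp add: commutator_def m_assoc inv_mult_group inv_cancel)

lemma commutator_one [simp]:
  "x \<in> carrier G \<Longrightarrow> commutator G x \<one> = \<one>" "x \<in> carrier G \<Longrightarrow> commutator G \<one> x = \<one>"
  by (simp_all add: commutator_def)

lemma conj_prod_closed:
  assumes "conj_prod G c J g" "c ` J \<subseteq> carrier G"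
  shows "g \<in> carrier G"
  using assms by (induction rule: conj_prod.induct) auto

text \<open>Conjugation by \<open>y\<close> distributes over the factors and replaces each
  conjugator \<open>z\<close> by \<open>z \<otimes> y\<close>.\<close>

lemma conj_prod_conjugate:
  assumes "conj_prod G c J g" "c ` J \<subseteq> carrier G" "y \<in> carrier G"
  shows "conj_prod G c J (inv y \<otimes> g \<otimes> y)"
  using assms
proof (induction rule: conj_prod.induct)
  case empty
  then show ?case by (simp add: conj_prod.empty)
next
  case (insert J g j z)
  have g: "g \<in> carrier G" using insert by (auto intro: conj_prod_closed)
  have "conj_prod G c (insert j J)
      (inv y \<otimes> g \<otimes> y \<otimes> (inv (z \<otimes> y) \<otimes> c j \<otimes> (z \<otimes> y)))"
    using insert by (intro conj_prod.insert) auto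
  also have "inv y \<otimes> g \<otimes> y \<otimes> (inv (z \<otimes> y) \<otimes> c j \<otimes> (z \<otimes> y))
      = inv y \<otimes> (g \<otimes> (inv z \<otimes> c j \<otimes> z)) \<otimes> y"
    using insert.prems insert.hyps g by (simp add: m_assoc inv_mult_group inv_cancel)
  finally show ?case .
qed

lemma conj_prod_Un:
  assumes "conj_prod G c K h" "conj_prod G c J g" "J \<inter> K = {}" "c ` (J \<union> K) \<subseteq> carrier G"
  shows "conj_prod G c (J \<union> K) (g \<otimes> h)"
  using assms
proof (induction rule: conj_prod.induct)
  case empty
  then show ?case by (simp add: conj_prod_closed)
next
  case (insert K h j z)
  have gh: "g \<in> carrier G" "h \<in> carrier G"
    using insert.prems insert.hyps
    by (auto intro: conj_prod_closed[of c J] conj_prod_closed[of c K])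
  have "conj_prod G c (insert j (J \<union> K)) (g \<otimes> h \<otimes> (inv z \<otimes> c j \<otimes> z))"
    using insert by (intro conj_prod.insert) auto
  with insert.prems insert.hyps gh show ?case by (simp add: m_assoc)
qed

text \<open>
  By \<open>uv = v (v\<^sup>-\<^sup>1 u v)\<close>, a factor moves past the later ones when its conjugator is changed.
\<close>

lemma conj_prod_remove:
  assumes "conj_prod G c J g" "i \<in> J" "c ` J \<subseteq> carrier G"
  obtains h z where "conj_prod G c (J - {i}) h" "z \<in> carrier G"
    "g = h \<otimes> (inv z \<otimes> c i \<otimes> z)"
proof -
  have "\<exists>h z. conj_prod G c (J - {i}) h \<and> z \<in> carrier G \<and> g = h \<otimes> (inv z \<otimes> c i \<otimes> z)"
    using assms
  proof (induction rule: conj_prod.induct)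
    case (insert J g j z)
    show ?case
    proof (cases "i = j")
      case True
      with insert show ?thesis by auto
    next
      case False
      with insert obtain h y where h: "conj_prod G c (J - {i}) h" "y \<in> carrier G"
        "g = h \<otimes> (inv y \<otimes> c i \<otimes> y)" by auto
      have hc: "h \<in> carrier G" using h(1) insert.prems by (auto intro: conj_prod_closed)
      define u where "u = inv z \<otimes> c j \<otimes> z"
      have c: "c i \<in> carrier G" "u \<in> carrier G"
        using insert.prems insert.hyps by (auto simp: u_def)
      have "conj_prod G c (insert j (J - {i})) (h \<otimes> u)"
        unfolding u_def using insert.hyps h by (intro conj_prod.insert) auto
      moreover have "insert j (J - {i}) = insert j J - {i}" using False by auto
      moreover have "g \<otimes> u = h \<otimes> u \<otimes> (inv (y \<otimes> u) \<otimes> c i \<otimes> (y \<otimes> u))"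
        using h(2) hc c by (simp add: h(3) m_assoc inv_mult_group inv_cancel)
      ultimately show ?thesis using h(2) c by (metis u_def m_closed)
    qed
  qed simp
  then show thesis using that by blast
qed

lemma ordered_prod_cong:
  "(\<And>j. j \<in> {1..k} \<Longrightarrow> f j = f' j) \<Longrightarrow> ordered_prod G f k = ordered_prod G f' k"
  by (induction k) auto

text \<open>The factor with the largest index is moved to the far right, and the remaining product
  is sorted recursively.\<close>

lemma conj_prod_imp_ordered_prod:
  assumes "conj_prod G c {1..k} g" "c ` {1..k} \<subseteq> carrier G"
  shows "\<exists>z \<in> {1..k} \<rightarrow> carrier G. ordered_prod G (\<lambda>j. inv (z j) \<otimes> c j \<otimes> z j) k = g"
  using assms
proof (induction k arbitrary: g)
  case 0
  then show ?case by (auto elim: conj_prod.cases)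
next
  case (Suc k)
  have "Suc k \<in> {1..Suc k}" by simp
  from conj_prod_remove[OF Suc.prems(1) this Suc.prems(2)]
  obtain h y where h: "conj_prod G c ({1..Suc k} - {Suc k}) h" "y \<in> carrier G"
    "g = h \<otimes> (inv y \<otimes> c (Suc k) \<otimes> y)"
    by blast
  have "{1..Suc k} - {Suc k} = {1..k}" by auto
  with h(1) have "conj_prod G c {1..k} h" by simp
  moreover have "c ` {1..k} \<subseteq> carrier G" using Suc.prems(2) by auto
  ultimately obtain z where z: "z \<in> {1..k} \<rightarrow> carrier G"
    "ordered_prod G (\<lambda>j. inv (z j) \<otimes> c j \<otimes> z j) k = h"
    using Suc.IH by blast
  define z' where "z' = z(Suc k := y)"
  have "ordered_prod G (\<lambda>j. inv (z' j) \<otimes> c j \<otimes> z' j) k = h"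
    unfolding z(2)[symmetric] by (rule ordered_prod_cong) (auto simp: z'_def)
  moreover have "z' \<in> {1..Suc k} \<rightarrow> carrier G"
    using z(1) h(2) by (auto simp: z'_def Pi_iff)
  ultimately show ?case using h(3) by (intro bexI[of _ z']) (auto simp: z'_def)
qed

text \<open>This fills a single bin: the expansion of [x, yz] splits off one item of
  \<open>J\<close> at a time, conjugated by the power of \<open>y\<close> belonging to the items
  still left.\<close>

lemma conj_prod_commutator_sum:
  assumes "finite J" "x \<in> carrier G" "y \<in> carrier G"
  shows "conj_prod G (\<lambda>j. commutator G x (y [^] (n j :: nat))) J (commutator G x (y [^] sum n J))"
  using assms(1)
proof (induction J)
  case empty
  then show ?case using assms by (simp add: conj_prod.empty)
next
  case (insert j J)
  have "commutator G x (y [^] sum n (insert j J)) = commutator G x (y [^] n j \<otimes> y [^] sum n J)"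
    using insert assms by (simp add: nat_pow_mult)
  also have "\<dots> = commutator G x (y [^] sum n J)
      \<otimes> (inv (y [^] sum n J) \<otimes> commutator G x (y [^] n j) \<otimes> y [^] sum n J)"
    using assms by (simp add: commutator_mult_right)
  finally show ?case
    using conj_prod.insert[OF insert.IH insert.hyps(2), of "y [^] sum n J"] assms by simp
qed

text \<open>This assembles the bins: the expansion of [xy, z] makes the commutator of
  \<open>x [^] N\<close> with \<open>y\<close> a product of \<open>N\<close> conjugates of [x, y],
  and bin \<open>i\<close> supplies one of them.\<close>

lemma conj_prod_commutator_pow:
  assumes "\<And>i. i \<in> {1..N} \<Longrightarrow> conj_prod G c (S i) (commutator G x y)"
    and "disjoint_family_on S {1..N}" and "c ` (\<Union>i\<in>{1..N}. S i) \<subseteq> carrier G"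
    and "x \<in> carrier G" "y \<in> carrier G"
  shows "conj_prod G c (\<Union>i\<in>{1..N}. S i) (commutator G (x [^] (N :: nat)) y)"
  using assms(1-3)
proof (induction N)
  case 0
  then show ?case using assms by (simp add: conj_prod.empty)
next
  case (Suc N)
  have eq: "(\<Union>i\<in>{1..Suc N}. S i) = S (Suc N) \<union> (\<Union>i\<in>{1..N}. S i)"
    by (auto simp: atLeastAtMostSuc_conv)
  have "conj_prod G c (\<Union>i\<in>{1..N}. S i) (commutator G (x [^] N) y)"
    using Suc.prems unfolding eq
    by (intro Suc.IH) (auto simp: disjoint_family_on_def image_subset_iff)
  moreover have "conj_prod G c (S (Suc N))
      (inv (x [^] N) \<otimes> commutator G x y \<otimes> x [^] N)"
  proof (rule conj_prod_conjugate)
    show "conj_prod G c (S (Suc N)) (commutator G x y)" by (rule Suc.prems(1)) simp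
    show "c ` S (Suc N) \<subseteq> carrier G" using Suc.prems(3) unfolding eq by blast
    show "x [^] N \<in> carrier G" using assms by simp
  qed
  moreover have "S (Suc N) \<inter> (\<Union>i\<in>{1..N}. S i) = {}"
  proof -
    have "S (Suc N) \<inter> S i = {}" if "i \<in> {1..N}" for i
      using that by (intro disjoint_family_onD[OF Suc.prems(2)]) auto
    then show ?thesis by blast
  qed
  ultimately have "conj_prod G c (\<Union>i\<in>{1..Suc N}. S i)
      (inv (x [^] N) \<otimes> commutator G x y \<otimes> x [^] N \<otimes> commutator G (x [^] N) y)"
    using Suc.prems(3) unfolding eq by (intro conj_prod_Un)
  \<comment> \<open>The power is split as \<open>x \<otimes> x [^] N\<close>, with the single
    \<open>x\<close> on the left, whereas the recursion for powers puts it on the right.\<close>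
  also have "\<dots> = commutator G (x [^] Suc N) y"
    using assms nat_pow_mult[of x 1 N] by (simp add: commutator_mult_left[symmetric])
  finally show ?case .
qed

end

section \<open>Homomorphic images of commutators and ordered products\<close>

lemma (in group_hom) hom_commutator:
  assumes "x \<in> carrier G" "y \<in> carrier G"
  shows "h (commutator G x y) = commutator H (h x) (h y)"
  using assms by (simp add: commutator_def)

lemma (in group_hom) hom_ordered_prod:
  assumes "f \<in> {1..k} \<rightarrow> carrier G"
  shows "h (ordered_prod G f k) = ordered_prod H (\<lambda>j. h (f j)) k"
proof -
  have "ordered_prod G f k \<in> carrier G \<and> ?thesis"
    using assms by (induction k) (auto simp: Pi_iff)
  then show ?thesis ..
qed

section \<open>The wreath product\<close>

text \<open>
  The pair \<open>(p, f)\<close> is the shift by \<open>p\<close> together with the base element \<open>f\<close>. Finiteness of the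
  support of \<open>f\<close> is never needed, so this is in fact the unrestricted wreath product.
\<close>

definition wreath :: "(int \<times> (int \<Rightarrow> int)) monoid" where
  "wreath = \<lparr>carrier = UNIV, mult = (\<lambda>(p, f) (q, g). (p + q, \<lambda>x. f x + g (x - p))),
     one = (0, \<lambda>_. 0)\<rparr>"

lemma wreath_simps [simp]:
  "carrier wreath = UNIV" "\<one>\<^bsub>wreath\<^esub> = (0, \<lambda>_. 0)"
  "(p, f) \<otimes>\<^bsub>wreath\<^esub> (q, g) = (p + q, \<lambda>x. f x + g (x - p))"
  by (simp_all add: wreath_def)

lemma group_wreath: "group wreath"
proof (rule groupI)
  fix u assume "u \<in> carrier wreath"
  show "\<exists>v\<in>carrier wreath. v \<otimes>\<^bsub>wreath\<^esub> u = \<one>\<^bsub>wreath\<^esub>"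
    by (cases u) (auto intro!: exI[of _ "- fst u"] exI[of _ "\<lambda>x. - snd u (x + fst u)"])
qed (auto simp: algebra_simps)

lemma inv_wreath [simp]: "inv\<^bsub>wreath\<^esub> (p, f) = (- p, \<lambda>x. - f (x + p))"
  by (rule group.inv_equality[OF group_wreath]) auto

definition dirac :: "int \<Rightarrow> int \<Rightarrow> int" where
  "dirac c x = (if x = c then 1 else 0)"

lemma wreath_pow_shift: "(1, \<lambda>_. 0) [^]\<^bsub>wreath\<^esub> (m :: nat) = (int m, \<lambda>_. 0)"
  by (induction m) auto

lemma wreath_pow_base: "(0, f) [^]\<^bsub>wreath\<^esub> (m :: nat) = (0, \<lambda>x. int m * f x)"
  by (induction m) (auto simp: algebra_simps)

text \<open>Conjugation by the shift moves the inverse of the base element to position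
  \<open>- p\<close>, while the base element itself stays at \<open>0\<close>.\<close>

lemma wreath_commutator:
  "commutator wreath (p, \<lambda>_. 0) (0, \<lambda>x. m * dirac 0 x) = (0, \<lambda>x. m * (dirac 0 x - dirac (- p) x))"
  by (auto simp: commutator_def dirac_def)

text \<open>The base group is abelian, so the base component of \<open>u\<close> cancels and only
  its shift acts.\<close>

lemma wreath_conjugate:
  "inv\<^bsub>wreath\<^esub> u \<otimes>\<^bsub>wreath\<^esub> (0, f) \<otimes>\<^bsub>wreath\<^esub> u = (0, \<lambda>x. f (x + fst u))"
  by (cases u) auto

lemma wreath_ordered_prod:
  "ordered_prod wreath (\<lambda>j. (0, f j)) k = (0, \<lambda>x. \<Sum>j\<in>{1..k}. f j x)"
  by (induction k) (auto simp: add.commute)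

section \<open>Reading off the bins\<close>

text \<open>The total at a position is constant away from the two jumps, and vanishes far to the right.\<close>

lemma weight_at_position:
  fixes c :: "'i \<Rightarrow> int" and n :: "'i \<Rightarrow> int"
  assumes "finite J"
    and jump: "\<And>x. (\<Sum>j\<in>J. n j * (dirac (c j) x - dirac (c j - 1) x))
      = B * (dirac 0 x - dirac (- int N) x)"
  shows "(\<Sum>j | j \<in> J \<and> c j = x. n j) = (if - int N < x \<and> x \<le> 0 then B else 0)"
proof -
  define W where "W = (\<lambda>x. \<Sum>j\<in>J. n j * dirac (c j) x)"
  \<comment> \<open>\<open>V\<close> is the deviation of the total \<open>W\<close> from its claimed
    value. Both terms have the same jumps, so \<open>V\<close> has none.\<close>
  define V where "V = (\<lambda>x. W x - (if - int N < x \<and> x \<le> 0 then B else 0))"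
  \<comment> \<open>As \<open>dirac (c j - 1) x = dirac (c j) (x + 1)\<close>, the hypothesis is a
    difference equation for \<open>W\<close>.\<close>
  have W: "W x - W (x + 1) = B * (dirac 0 x - dirac (- int N) x)" for x
    unfolding jump[symmetric]
    by (auto simp: W_def sum_subtractf[symmetric] dirac_def algebra_simps intro!: sum.cong)
  have step: "V x = V (x + 1)" for x
    using W[of x] by (auto simp: V_def dirac_def split: if_splits)
  have const: "V x = V (x + int m)" for x m
  proof (induction m)
    case (Suc m)
    have "V (x + int m) = V (x + int (Suc m))"
      using step[of "x + int m"] by (simp add: ac_simps)
    with Suc show ?case by (rule trans)
  qed simp
  have "\<exists>m. V (x + int m) = 0"
  proof -
    obtain M where M: "\<forall>j\<in>J. c j \<le> M" using assms(1)
      by (meson bdd_above.E bdd_above_finite finite_imageI imageI)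
    \<comment> \<open>This shift takes \<open>x\<close> beyond both \<open>0\<close> and every
      \<open>c j\<close>, where both terms of \<open>V\<close> vanish.\<close>
    define m where "m = nat (max 0 (max 0 M + 1 - x))"
    have "x + int m > 0" "x + int m > M" by (auto simp: m_def)
    then have "V (x + int m) = 0" using M by (auto simp: V_def W_def dirac_def intro!: sum.neutral)
    then show ?thesis ..
  qed
  with const have "V x = 0" by metis
  moreover have "W x = (\<Sum>j | j \<in> J \<and> c j = x. n j)"
    using assms(1) by (simp add: W_def dirac_def sum.inter_filter if_distrib eq_commute cong: if_cong)
  ultimately show ?thesis by (simp add: V_def)
qed

lemma exact_bin_packing_if_weights:
  fixes c :: "nat \<Rightarrow> int"
  assumes pos: "\<forall>j\<in>{1..k}. n j > 0"
    and weight: "\<And>x. (\<Sum>j | j \<in> {1..k} \<and> c j = x. int (n j))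
      = (if - int N < x \<and> x \<le> 0 then int B else 0)"
  shows "exact_bin_packing k n B N"
proof -
  \<comment> \<open>The offset matches the bins 1, ..., \<open>N\<close> with the positions 0, -1,
    ..., 1 - \<open>N\<close>.\<close>
  define S where "S = (\<lambda>i. {j \<in> {1..k}. c j = 1 - int i})"
  \<comment> \<open>An item outside these positions would contribute a positive weight to a total
    that is zero.\<close>
  have range: "- int N < c j \<and> c j \<le> 0" if "j \<in> {1..k}" for j
  proof (rule ccontr)
    assume "\<not> ?thesis"
    then have "(\<Sum>i | i \<in> {1..k} \<and> c i = c j. int (n i)) = 0" using weight by auto
    then have "int (n j) = 0" using that by (subst (asm) sum_nonneg_eq_0_iff) auto
    with bspec[OF pos that] show False by simp
  qed
  have "(\<Union>i\<in>{1..N}. S i) = {1..k}"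
  proof
    show "{1..k} \<subseteq> (\<Union>i\<in>{1..N}. S i)"
    proof
      fix j assume j: "j \<in> {1..k}"
      have "nat (1 - c j) \<in> {1..N}" "j \<in> S (nat (1 - c j))"
        using range[OF j] j by (auto simp: S_def)
      then show "j \<in> (\<Union>i\<in>{1..N}. S i)" by blast
    qed
  qed (auto simp: S_def)
  moreover have "disjoint_family_on S {1..N}"
    by (auto simp: disjoint_family_on_def S_def)
  moreover have "sum n (S i) = B" if "i \<in> {1..N}" for i
  proof -
    have "int (sum n (S i)) = int B" using weight[of "1 - int i"] that by (simp add: S_def)
    then show ?thesis by (simp only: of_nat_eq_iff)
  qed
  ultimately show ?thesis unfolding exact_bin_packing_def by blast
qed

section \<open>Solutions in the free group versus packings\<close>

theorem theorem3p10:
  fixes A :: "'a set" and a b :: 'a and k B N :: nat and n :: "nat \<Rightarrow> nat"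
  assumes "finite A" and "a \<in> A" and "b \<in> A" and "a \<noteq> b"
    and "k \<ge> 1" and "\<forall>j\<in>{1..k}. n j > 0" and "B > 0" and "N > 0"
  shows "(\<exists>z \<in> {1..k} \<rightarrow> carrier (free_group A).
            ordered_prod (free_group A)
              (\<lambda>j. inv\<^bsub>free_group A\<^esub> (z j)
                   \<otimes>\<^bsub>free_group A\<^esub> commutator (free_group A) (gen a) (gen b [^]\<^bsub>free_group A\<^esub> n j)
                   \<otimes>\<^bsub>free_group A\<^esub> z j) k
            = commutator (free_group A) (gen a [^]\<^bsub>free_group A\<^esub> N) (gen b [^]\<^bsub>free_group A\<^esub> B))
         \<longleftrightarrow> exact_bin_packing k n B N"
proof -
  let ?F = "free_group A"
  let ?c = "\<lambda>j. commutator ?F (gen a) (gen b [^]\<^bsub>?F\<^esub> n j)"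
  interpret F: group ?F by (rule group_free_group)
  have ab: "gen a \<in> carrier ?F" "gen b \<in> carrier ?F"
    using assms by (auto intro: gen_closed)
  have c_closed: "?c j \<in> carrier ?F" for j using ab by (simp add: F.commutator_closed)
  show ?thesis
  proof
    assume "exact_bin_packing k n B N"
    then obtain S where S: "(\<Union>i\<in>{1..N}. S i) = {1..k}" "disjoint_family_on S {1..N}"
      "\<forall>i\<in>{1..N}. sum n (S i) = B"
      unfolding exact_bin_packing_def by blast
    have "conj_prod ?F ?c (S i) (commutator ?F (gen a) (gen b [^]\<^bsub>?F\<^esub> B))" if i: "i \<in> {1..N}" for i
    proof -
      have "S i \<subseteq> {1..k}" using S(1) i by blast
      then have "finite (S i)" by (rule finite_subset) simp
      from F.conj_prod_commutator_sum[OF this ab, of n] S(3) i show ?thesis by simp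
    qed
    then have "conj_prod ?F ?c (\<Union>i\<in>{1..N}. S i)
        (commutator ?F (gen a [^]\<^bsub>?F\<^esub> N) (gen b [^]\<^bsub>?F\<^esub> B))"
      using S(2) c_closed ab by (intro F.conj_prod_commutator_pow) auto
    then have "conj_prod ?F ?c {1..k}
        (commutator ?F (gen a [^]\<^bsub>?F\<^esub> N) (gen b [^]\<^bsub>?F\<^esub> B))" unfolding S(1) .
    from F.conj_prod_imp_ordered_prod[OF this] c_closed
    show "\<exists>z \<in> {1..k} \<rightarrow> carrier ?F.
        ordered_prod ?F (\<lambda>j. inv\<^bsub>?F\<^esub> (z j) \<otimes>\<^bsub>?F\<^esub> ?c j \<otimes>\<^bsub>?F\<^esub> z j) k
          = commutator ?F (gen a [^]\<^bsub>?F\<^esub> N) (gen b [^]\<^bsub>?F\<^esub> B)"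
      by blast
  next
    assume "\<exists>z \<in> {1..k} \<rightarrow> carrier ?F.
        ordered_prod ?F (\<lambda>j. inv\<^bsub>?F\<^esub> (z j) \<otimes>\<^bsub>?F\<^esub> ?c j \<otimes>\<^bsub>?F\<^esub> z j) k
          = commutator ?F (gen a [^]\<^bsub>?F\<^esub> N) (gen b [^]\<^bsub>?F\<^esub> B)"
    then obtain z where z: "z \<in> {1..k} \<rightarrow> carrier ?F"
      and eq: "ordered_prod ?F (\<lambda>j. inv\<^bsub>?F\<^esub> (z j) \<otimes>\<^bsub>?F\<^esub> ?c j \<otimes>\<^bsub>?F\<^esub> z j) k
          = commutator ?F (gen a [^]\<^bsub>?F\<^esub> N) (gen b [^]\<^bsub>?F\<^esub> B)"
      by blast
    \<comment> \<open>Letters other than \<open>a\<close> and \<open>b\<close> are sent to the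
      identity.\<close>
    define f where "f = (\<lambda>x. if x = a then (1, \<lambda>_. 0) else if x = b then (0, dirac 0)
        else \<one>\<^bsub>wreath\<^esub>)"
    define h where "h = lift wreath f"
    have f: "f \<in> A \<rightarrow> carrier wreath" by simp
    interpret W: group wreath by (rule group_wreath)
    interpret h: group_hom ?F wreath h
      using lift_hom(1)[OF group_wreath f] by unfold_locales (simp add: h_def)
    have hab: "h (gen a) = (1, \<lambda>_. 0)" "h (gen b) = (0, dirac 0)"
      using lift_hom(2)[OF group_wreath f] assms by (simp_all add: h_def f_def)
    have hcomm: "h (commutator ?F (gen a [^]\<^bsub>?F\<^esub> p) (gen b [^]\<^bsub>?F\<^esub> m))
        = (0, \<lambda>x. int m * (dirac 0 x - dirac (- int p) x))" for p m :: nat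
      using ab
      by (simp add: h.hom_commutator h.hom_nat_pow hab wreath_pow_shift wreath_pow_base
          wreath_commutator)
    have hc: "h (?c j) = (0, \<lambda>x. int (n j) * (dirac 0 x - dirac (- 1) x))" for j
      using hcomm[of 1 "n j"] ab by simp
    \<comment> \<open>Conjugation by an element with shift \<open>p\<close> carries a unit mass at
      \<open>0\<close> to \<open>- p\<close>, hence the sign: \<open>c j\<close> is the position of
      item \<open>j\<close>.\<close>
    define c where "c = (\<lambda>j. - fst (h (z j)))"
    have hconj: "h (inv\<^bsub>?F\<^esub> (z j) \<otimes>\<^bsub>?F\<^esub> ?c j \<otimes>\<^bsub>?F\<^esub> z j)
        = (0, \<lambda>x. int (n j) * (dirac (c j) x - dirac (c j - 1) x))" if "j \<in> {1..k}" for j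
    proof -
      have "z j \<in> carrier ?F" using z that by auto
      then have "h (inv\<^bsub>?F\<^esub> (z j) \<otimes>\<^bsub>?F\<^esub> ?c j \<otimes>\<^bsub>?F\<^esub> z j)
          = inv\<^bsub>wreath\<^esub> h (z j) \<otimes>\<^bsub>wreath\<^esub> h (?c j) \<otimes>\<^bsub>wreath\<^esub> h (z j)"
        using c_closed by simp
      also have "\<dots> = (0, \<lambda>x. int (n j) * (dirac (c j) x - dirac (c j - 1) x))"
        unfolding hc wreath_conjugate by (auto simp: dirac_def c_def)
      finally show ?thesis .
    qed
    \<comment> \<open>The image of the equation under \<open>h\<close> is computed on both sides,
      and the base components are compared.\<close>
    have "(0, \<lambda>x. int B * (dirac 0 x - dirac (- int N) x))
        = h (ordered_prod ?F (\<lambda>j. inv\<^bsub>?F\<^esub> (z j) \<otimes>\<^bsub>?F\<^esub> ?c j \<otimes>\<^bsub>?F\<^esub> z j) k)"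
      by (simp add: eq hcomm)
    also have "\<dots> = ordered_prod wreath
        (\<lambda>j. h (inv\<^bsub>?F\<^esub> (z j) \<otimes>\<^bsub>?F\<^esub> ?c j \<otimes>\<^bsub>?F\<^esub> z j)) k"
      using z c_closed by (intro h.hom_ordered_prod) auto
    also have "\<dots> = ordered_prod wreath
        (\<lambda>j. (0, \<lambda>x. int (n j) * (dirac (c j) x - dirac (c j - 1) x))) k"
      by (rule W.ordered_prod_cong) (rule hconj)
    also have "\<dots> = (0, \<lambda>x. \<Sum>j\<in>{1..k}. int (n j) * (dirac (c j) x - dirac (c j - 1) x))"
      by (rule wreath_ordered_prod)
    finally have "(\<Sum>j\<in>{1..k}. int (n j) * (dirac (c j) x - dirac (c j - 1) x))
        = int B * (dirac 0 x - dirac (- int N) x)" for x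
      by (simp add: fun_eq_iff)
    then have "(\<Sum>j | j \<in> {1..k} \<and> c j = x. int (n j))
        = (if - int N < x \<and> x \<le> 0 then int B else 0)" for x
      by (intro weight_at_position) auto
    with assms show "exact_bin_packing k n B N" by (intro exact_bin_packing_if_weights)
  qed
qed

end
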